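(* Let $\Sigma$ be a finite alphabet with $|\Sigma|\ge 2$, let $\Sigma^*$ be the set of all words over $\Sigma$, and for each $n$ let $C_n=\{w\in\Sigma^* : C(w)\le n\}$, where $C(w)$ denotes the Kolmogorov complexity of $w$. Let $T$ be a computably enumerable set and let $\iota:\Sigma^*\to T$ be a computable bijection. If $Y\subset T$ is an infinite decidable subset, then $Y$ has positive lower asymptotic density with respect to the decomposition $T=\bigcup_n\iota(C_n)$; that is, $$\liminf_{n\to\infty}\frac{|Y\cap \iota(C_n)|}{|\iota(C_n)|}>0.$$
   Context: $|\cdot|$ applied to a set denotes cardinality; applied to a word it denotes length. Elements of $T$ are finite objects coded, for instance, as words over a finite alphabet. $Y\subset T$ is decidable if there is an algorithm which, given an element of $T$, decides whether it belongs to $Y$. Kolmogorov complexity is defined as follows. Fix a Turing complete programming language $\mathcal L$ over a finite alphabet $\Delta\supset\Sigma$, whose programs are used to compute functions from $\Sigma^*$ to $\Sigma^*$. (Turing complete, as usual, means that every partial computable function $\Sigma^*\to\Sigma^*$ is computed by some program, and running a given program on a given input is an effective process.) Programs are coded as words over $\Sigma$: each letter of $\Delta$ is coded by a distinct word of a fixed length $\ell$ over $\Sigma$, with $\ell$ large enough that there is an additional reserved word of length $\ell$, not coding any letter, which signals the end of a program. Thus a (coded) program is a word over $\Sigma$ consisting of blocks of length $\ell$ that code the letters of the original program, followed by the reserved block as a suffix. From here on "program" means coded program. A description of $w\in\Sigma^*$ is a word in $\Sigma^*$ of the form $pv$ where $p$ is a program, $v\in\Sigma^*$ is a word, and $p$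 with input $v$ computes (halts with output) $w$. By the coding convention, an arbitrary word can be written as a description $pv$ in at most one way. The Kolmogorov complexity $C(w)$ is the length of a shortest description of $w$. The language $\mathcal L$ and the coding are fixed throughout. *)

theory Defs
  imports Complex_Main "HOL-Library.Extended_Real" "HOL-Library.Countable_Set"
begin

section \<open>Partial recursive functions\<close>

text \<open>
  Kleene's partial recursive functions. Terms carry no arity: a term denotes one partial function
  on \<open>nat\<close>-tuples for every tuple length, with no value where the tuple has the wrong shape.
  In \<open>PrimRec\<close> and \<open>Mu\<close> the first argument is the recursion or search variable.
\<close>

datatype recf =
    Zero
  | Succ
  | Proj nat
  | Comp recf "recf list"
  | PrimRec recf recf
  | Mu recf

inductive rec_eval :: "recf \<Rightarrow> nat list \<Rightarrow> nat \<Rightarrow> bool" where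
  Zero: "rec_eval Zero xs 0"
| Succ: "rec_eval Succ [x] (Suc x)"
| Proj: "i < length xs \<Longrightarrow> rec_eval (Proj i) xs (xs ! i)"
| Comp: "list_all2 (\<lambda>g y. rec_eval g xs y) gs ys \<Longrightarrow> rec_eval f ys z \<Longrightarrow> rec_eval (Comp f gs) xs z"
| PrimRec_0: "rec_eval f xs y \<Longrightarrow> rec_eval (PrimRec f g) (0 # xs) y"
| PrimRec_Suc: "rec_eval (PrimRec f g) (n # xs) y \<Longrightarrow> rec_eval g (n # y # xs) z \<Longrightarrow>
    rec_eval (PrimRec f g) (Suc n # xs) z"
| Mu: "rec_eval f (n # xs) 0 \<Longrightarrow> (\<forall>i<n. \<exists>y. rec_eval f (i # xs) (Suc y)) \<Longrightarrow> rec_eval (Mu f) xs n"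

inductive_cases rec_eval_ZeroE: "rec_eval Zero xs y"
inductive_cases rec_eval_SuccE: "rec_eval Succ xs y"
inductive_cases rec_eval_ProjE: "rec_eval (Proj i) xs y"
inductive_cases rec_eval_CompE: "rec_eval (Comp f gs) xs y"
inductive_cases rec_eval_PrimRec0E: "rec_eval (PrimRec f g) (0 # xs) y"
inductive_cases rec_eval_PrimRecSucE: "rec_eval (PrimRec f g) (Suc n # xs) y"
inductive_cases rec_eval_MuE: "rec_eval (Mu f) xs y"

lemma rec_eval_deterministic:
  "rec_eval f xs y \<Longrightarrow> rec_eval f xs z \<Longrightarrow> y = z"
proof (induction arbitrary: z rule: rec_eval.induct)
  case (Comp xs gs ys f w)
  from Comp.prems obtain ys' where ys': "list_all2 (\<lambda>g y. rec_eval g xs y) gs ys'" "rec_eval f ys' z"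
    by (rule rec_eval_CompE)
  have "ys = ys'"
    using Comp.IH(1) ys'(1) unfolding list_all2_conv_all_nth list_eq_iff_nth_eq by auto
  with Comp.IH(2) ys'(2) show ?case by blast
next
  case (Mu f n xs)
  from Mu.prems have z: "rec_eval f (z # xs) 0" "\<forall>i<z. \<exists>y. rec_eval f (i # xs) (Suc y)"
    by (auto elim: rec_eval_MuE)
  show ?case
  proof (rule linorder_cases[of n z])
    assume "n < z"
    with z(2) obtain y where "rec_eval f (n # xs) (Suc y)" by blast
    with Mu.IH(1) show ?thesis by blast
  next
    assume "z < n"
    with Mu.IH(2) z(1) show ?thesis by blast
  qed
qed (blast elim: rec_eval_ZeroE rec_eval_SuccE rec_eval_ProjE rec_eval_PrimRec0E rec_eval_PrimRecSucE)+

text \<open>The result \<open>None\<close> stands for divergence.\<close>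

definition rec_computes :: "recf \<Rightarrow> nat list \<Rightarrow> nat option \<Rightarrow> bool" where
  "rec_computes f xs r \<longleftrightarrow> (\<forall>y. rec_eval f xs y \<longleftrightarrow> r = Some y)"

section \<open>Computability on words\<close>

text \<open>
  The set of words over an alphabet \<open>A\<close> is \<^term>\<open>lists A\<close>. Words are numbered by bijective base-\<open>card A\<close>
  numeration, least significant letter first; for a finite alphabet \<open>A\<close>, \<^term>\<open>to_nat_on A\<close> is a
  bijection from \<open>A\<close> onto \<open>{..<card A}\<close>.
\<close>

fun wnum :: "'a set \<Rightarrow> 'a list \<Rightarrow> nat" where
  "wnum A [] = 0"
| "wnum A (x # xs) = Suc (to_nat_on A x) + card A * wnum A xs"

definition partial_computable ::
    "'a set \<Rightarrow> 'b set \<Rightarrow> ('a list \<Rightarrow> 'b list option) \<Rightarrow> bool" where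
  "partial_computable A B g \<longleftrightarrow>
     (\<forall>w\<in>lists A. set_option (g w) \<subseteq> lists B) \<and>
     (\<exists>f. \<forall>w\<in>lists A. rec_computes f [wnum A w] (map_option (wnum B) (g w)))"

definition computable :: "'a set \<Rightarrow> 'b set \<Rightarrow> ('a list \<Rightarrow> 'b list) \<Rightarrow> bool" where
  "computable A B g \<longleftrightarrow> partial_computable A B (\<lambda>w. Some (g w))"

definition computably_enumerable :: "'a set \<Rightarrow> 'a list set \<Rightarrow> bool" where
  "computably_enumerable A X \<longleftrightarrow>
     X \<subseteq> lists A \<and> (\<exists>f. \<forall>w\<in>lists A. w \<in> X \<longleftrightarrow> (\<exists>y. rec_eval f [wnum A w] y))"

text \<open>
  The elements of \<open>T\<close> are given through their codes, which are words over \<open>A\<close>. The algorithm has to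
  answer only on codes of elements of \<open>T\<close>; its behaviour on other words is unconstrained.
\<close>

definition decidable_subset ::
    "'a set \<Rightarrow> ('t \<Rightarrow> 'a list) \<Rightarrow> 't set \<Rightarrow> 't set \<Rightarrow> bool" where
  "decidable_subset A code T Y \<longleftrightarrow>
     Y \<subseteq> T \<and> (\<exists>f. \<forall>t\<in>T. rec_eval f [wnum A (code t)] (if t \<in> Y then 1 else 0))"

section \<open>Kolmogorov complexity\<close>

text \<open>
  A programming language over \<open>\<Delta>\<close> is given by its set \<open>P\<close> of (uncoded) programs and by the result
  \<open>run p v\<close> of running \<open>p\<close> on the input \<open>v\<close>. The last two conjuncts are Turing completeness: every
  partial computable function is computed by a program, and running programs is effective.
\<close>

definition turing_complete_language ::
    "'a set \<Rightarrow> 'a set \<Rightarrow> 'a list set \<Rightarrow> ('a list \<Rightarrow> 'a list \<Rightarrow> 'a list option) \<Rightarrow> bool" where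
  "turing_complete_language \<Sigma> \<Delta> P run \<longleftrightarrow>
     finite \<Delta> \<and> \<Sigma> \<subseteq> \<Delta> \<and> P \<subseteq> lists \<Delta> \<and>
     (\<forall>p\<in>P. \<forall>v\<in>lists \<Sigma>. set_option (run p v) \<subseteq> lists \<Sigma>) \<and>
     (\<forall>g. partial_computable \<Sigma> \<Sigma> g \<longrightarrow> (\<exists>p\<in>P. \<forall>v\<in>lists \<Sigma>. run p v = g v)) \<and>
     (\<exists>f. \<forall>p\<in>P. \<forall>v\<in>lists \<Sigma>.
        rec_computes f [wnum \<Delta> p, wnum \<Sigma> v] (map_option (wnum \<Sigma>) (run p v)))"

definition program_coding ::
    "'a set \<Rightarrow> 'a set \<Rightarrow> nat \<Rightarrow> ('a \<Rightarrow> 'a list) \<Rightarrow> 'a list \<Rightarrow> bool" where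
  "program_coding \<Sigma> \<Delta> l block stop \<longleftrightarrow>
     (\<forall>d\<in>\<Delta>. block d \<in> lists \<Sigma> \<and> length (block d) = l) \<and> inj_on block \<Delta> \<and>
     stop \<in> lists \<Sigma> \<and> length stop = l \<and> stop \<notin> block ` \<Delta>"

definition coded_program :: "('a \<Rightarrow> 'a list) \<Rightarrow> 'a list \<Rightarrow> 'a list \<Rightarrow> 'a list" where
  "coded_program block stop p = concat (map block p) @ stop"

definition is_description ::
    "'a set \<Rightarrow> 'a list set \<Rightarrow> ('a list \<Rightarrow> 'a list \<Rightarrow> 'a list option) \<Rightarrow>
     ('a \<Rightarrow> 'a list) \<Rightarrow> 'a list \<Rightarrow> 'a list \<Rightarrow> 'a list \<Rightarrow> bool" where
  "is_description \<Sigma> P run block stop d w \<longleftrightarrow>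
     (\<exists>p\<in>P. \<exists>v\<in>lists \<Sigma>. d = coded_program block stop p @ v \<and> run p v = Some w)"

definition kolmogorov_complexity ::
    "'a set \<Rightarrow> 'a list set \<Rightarrow> ('a list \<Rightarrow> 'a list \<Rightarrow> 'a list option) \<Rightarrow>
     ('a \<Rightarrow> 'a list) \<Rightarrow> 'a list \<Rightarrow> 'a list \<Rightarrow> nat" where
  "kolmogorov_complexity \<Sigma> P run block stop w =
     (LEAST n. \<exists>d. is_description \<Sigma> P run block stop d w \<and> length d = n)"

text \<open>The \<open>LEAST\<close> is attained: every word has a description.\<close>

lemma rec_computes_const: "\<exists>f. \<forall>xs. rec_computes f xs (Some c)"
proof -
  have "\<exists>f. \<forall>xs. rec_eval f xs c"
  proof (induction c)
    case 0
    show ?case by (blast intro: rec_eval.Zero)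
  next
    case (Suc c)
    then obtain f where f: "rec_eval f xs c" for xs by blast
    have "rec_eval (Comp Succ [f]) xs (Suc c)" for xs
      by (rule rec_eval.Comp[of _ _ "[c]"]) (auto intro: f rec_eval.Succ)
    then show ?case by blast
  qed
  then show ?thesis
    unfolding rec_computes_def by (metis option.inject rec_eval_deterministic)
qed

lemma is_description_exists:
  assumes "turing_complete_language \<Sigma> \<Delta> P run" "w \<in> lists \<Sigma>"
  shows "\<exists>d. is_description \<Sigma> P run block stop d w"
proof -
  have "partial_computable \<Sigma> \<Sigma> (\<lambda>_. Some w)"
    using assms(2) rec_computes_const[of "wnum \<Sigma> w"] unfolding partial_computable_def by auto
  with assms(1) obtain p where "p \<in> P" "\<forall>v\<in>lists \<Sigma>. run p v = Some w"
    unfolding turing_complete_language_def by meson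
  moreover have "[] \<in> lists \<Sigma>" by simp
  ultimately show ?thesis unfolding is_description_def by blast
qed

definition words_of_complexity_le ::
    "'a set \<Rightarrow> 'a list set \<Rightarrow> ('a list \<Rightarrow> 'a list \<Rightarrow> 'a list option) \<Rightarrow>
     ('a \<Rightarrow> 'a list) \<Rightarrow> 'a list \<Rightarrow> nat \<Rightarrow> 'a list set" where
  "words_of_complexity_le \<Sigma> P run block stop n =
     {w \<in> lists \<Sigma>. kolmogorov_complexity \<Sigma> P run block stop w \<le> n}"

section \<open>Density\<close>

text \<open>
  Terms with \<open>D n = {}\<close> count as \<open>0 / 0 = 0\<close>; for an increasing sequence of finite sets with nonempty
  union there are only finitely many of them.
\<close>

definition lower_asymptotic_density :: "(nat \<Rightarrow> 't set) \<Rightarrow> 't set \<Rightarrow> ereal" where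
  "lower_asymptotic_density D Y =
     liminf (\<lambda>n. ereal (real (card (Y \<inter> D n)) / real (card (D n))))"

end

theory Submission imports Defs begin

text \<open>
  Write \<open>k = card \<Sigma>\<close> and let \<open>C\<^sub>n\<close> be the set of words of complexity at most \<open>n\<close>. Both \<open>Y \<inter> \<iota> ` C\<^sub>n\<close> and \<open>\<iota> ` C\<^sub>n\<close> have cardinality \<open>k\<^sup>n\<close> up to a constant factor.

  The upper bound \<open>card C\<^sub>n \<le> k ^ (n + 1)\<close> is a count of descriptions: because the reserved block
  marks where the program ends, a word is a description of at most one word, and there are at most
  \<open>k ^ (n + 1)\<close> words of length at most \<open>n\<close> (\<open>card_words_of_complexity_le_upper\<close>).

  For the lower bound, the words \<open>w\<close> with \<open>\<iota> w \<in> Y\<close> form an infinite decidable set, whose elements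
  can be listed in increasing order by unbounded search (\<open>rec_eval_enumerate\<close>). This gives a
  computable injection \<open>h\<close> of \<open>\<Sigma>\<^sup>*\<close> into that set (\<open>decidable_infinite_imp_computable_injection\<close>).
  By Turing completeness a program of some coded length \<open>c\<close> computes \<open>h\<close>, so prefixing it to \<open>v\<close> describes
  \<open>h v\<close>, and \<open>h\<close> maps the \<open>k ^ (n - c)\<close> words of length \<open>n - c\<close> into \<open>C\<^sub>n\<close>
  (\<open>card_words_of_complexity_le_lower\<close>). The ratio is therefore at least \<open>1 / k ^ (c + 1)\<close> for
  all \<open>n \<ge> c\<close>.
\<close>

section \<open>Words as numbers\<close>

lemma wnum_eq_0_iff [simp]: "wnum A w = 0 \<longleftrightarrow> w = []"
  by (cases w) auto

text \<open>
  Bijective numeration uses the digits \<open>1, \<dots>, card A\<close>. Subtracting 1 from a positive number turns the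
  recursion into Euclidean division by \<open>card A\<close>, so uniqueness and existence of quotient and
  remainder give injectivity and surjectivity.
\<close>

lemma bij_betw_wnum:
  assumes "finite A" "A \<noteq> {}"
  shows "bij_betw (wnum A) (lists A) UNIV"
proof -
  have digit: "bij_betw (to_nat_on A) A {..<card A}"
    using assms(1) by (rule to_nat_on_finite)
  have pos: "card A > 0"
    using assms by (simp add: card_gt_0_iff)
  have "v = w" if "v \<in> lists A" "w \<in> lists A" "wnum A v = wnum A w" for v w
    using that
  proof (induction v arbitrary: w rule: list.induct)
    case Nil
    then show ?case by (metis wnum_eq_0_iff)
  next
    case (Cons x v)
    then obtain y u where w: "w = y # u" by (cases w) auto
    have xy: "x \<in> A" "y \<in> A" using Cons.prems w by auto
    have lt: "to_nat_on A x < card A" "to_nat_on A y < card A"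
      using xy digit by (auto simp: bij_betw_def)
    have eq: "to_nat_on A x + card A * wnum A v = to_nat_on A y + card A * wnum A u"
      using Cons.prems w by simp
    from arg_cong[OF eq, of "\<lambda>n. n mod card A"] lt have "to_nat_on A x = to_nat_on A y"
      by simp
    moreover from this eq pos have "wnum A v = wnum A u" by simp
    then have "v = u"
      using Cons.IH[of u] Cons.prems w by simp
    ultimately show ?case
      using w xy digit inj_onD[of "to_nat_on A" A x y] by (simp add: bij_betw_def)
  qed
  then have inj: "inj_on (wnum A) (lists A)" by (intro inj_onI)
  have "\<exists>w\<in>lists A. wnum A w = n" for n
  proof (induction n rule: less_induct)
    case (less n)
    show ?case
    proof (cases n)
      case 0
      then show ?thesis by (intro bexI[of _ "[]"]) auto
    next
      case (Suc m)
      have "m div card A < n" using Suc by (simp add: le_imp_less_Suc)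
      with less obtain w where w: "w \<in> lists A" "wnum A w = m div card A" by blast
      have "m mod card A \<in> to_nat_on A ` A"
        using digit pos by (auto simp: bij_betw_def)
      then obtain x where x: "x \<in> A" "to_nat_on A x = m mod card A" by auto
      show ?thesis
        using w x Suc by (intro bexI[of _ "x # w"]) auto
    qed
  qed
  then have "wnum A ` lists A = UNIV" by (auto simp: image_def) (metis)
  with inj show ?thesis by (simp add: bij_betw_def)
qed

section \<open>Enumerating an infinite decidable set\<close>

lemma rec_eval_Comp1:
  "rec_eval g xs y \<Longrightarrow> rec_eval f [y] z \<Longrightarrow> rec_eval (Comp f [g]) xs z"
  by (rule rec_eval.Comp[of _ _ "[y]"]) auto

lemma rec_eval_Comp2:
  "rec_eval g xs y \<Longrightarrow> rec_eval g' xs y' \<Longrightarrow> rec_eval f [y, y'] z \<Longrightarrow>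
    rec_eval (Comp f [g, g']) xs z"
  by (rule rec_eval.Comp[of _ _ "[y, y']"]) auto

lemma rec_eval_Proj0: "rec_eval (Proj 0) (x # xs) x"
  using rec_eval.Proj[of 0 "x # xs"] by simp

lemma rec_eval_Proj1: "rec_eval (Proj 1) (x # y # xs) y"
  using rec_eval.Proj[of 1 "x # y # xs"] by simp

lemma rec_computes_SomeI: "rec_eval f xs y \<Longrightarrow> rec_computes f xs (Some y)"
  unfolding rec_computes_def using rec_eval_deterministic by blast

lemma rec_computes_SomeD: "rec_computes f xs (Some y) \<Longrightarrow> rec_eval f xs y"
  unfolding rec_computes_def by simp

definition rec_pred :: recf where
  "rec_pred = PrimRec Zero (Proj 0)"

lemma rec_eval_pred: "rec_eval rec_pred [n] (n - 1)"
proof (induction n)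
  case 0
  show ?case
    unfolding rec_pred_def by (auto intro: rec_eval.intros)
next
  case (Suc n)
  then show ?case
    unfolding rec_pred_def using rec_eval.PrimRec_Suc rec_eval_Proj0 by fastforce
qed

text \<open>The recursion variable is the first argument, so this is subtraction with its arguments exchanged.\<close>

definition rec_monus :: recf where
  "rec_monus = PrimRec (Proj 0) (Comp rec_pred [Proj 1])"

lemma rec_eval_monus: "rec_eval rec_monus [m, n] (n - m)"
proof (induction m)
  case 0
  show ?case
    unfolding rec_monus_def by (auto intro: rec_eval.PrimRec_0 rec_eval_Proj0)
next
  case (Suc m)
  have "rec_eval (Comp rec_pred [Proj 1]) [m, n - m, n] (n - m - 1)"
    by (intro rec_eval_Comp1[OF rec_eval_Proj1] rec_eval_pred)
  with Suc show ?case
    unfolding rec_monus_def using rec_eval.PrimRec_Suc by fastforce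
qed

text \<open>
  Branching on a 0/1 value is a degenerate primitive recursion. When the candidate \<open>j\<close> is rejected by the
  decision procedure the branch returns 1, which keeps the search going; otherwise it returns
  \<open>m - j\<close>, which vanishes exactly when \<open>j \<ge> m\<close>.
\<close>

definition rec_next_test :: "recf \<Rightarrow> recf" where
  "rec_next_test c =
     Comp (PrimRec (Comp Succ [Zero]) (Proj 2)) [Comp c [Proj 0], rec_monus]"

lemma rec_eval_next_test:
  assumes "rec_eval c [j] (if j \<in> S then 1 else 0)"
  shows "rec_eval (rec_next_test c) [j, m] (if j \<in> S then m - j else 1)"
proof -
  have zero: "rec_eval (PrimRec (Comp Succ [Zero]) (Proj 2)) [0, x] 1" for x
    using rec_eval.Succ[of 0]
    by (auto intro!: rec_eval.PrimRec_0 rec_eval_Comp1[OF rec_eval.Zero])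
  have "rec_eval (PrimRec (Comp Succ [Zero]) (Proj 2)) [1, x] x" for x
    using rec_eval.PrimRec_Suc[OF zero rec_eval.Proj[of 2 "[0, 1, x]" for x]] by simp
  with zero have branch: "rec_eval (PrimRec (Comp Succ [Zero]) (Proj 2))
      [if j \<in> S then 1 else 0, m - j] (if j \<in> S then m - j else 1)"
    by simp
  have "rec_eval (Comp c [Proj 0]) [j, m] (if j \<in> S then 1 else 0)"
    by (rule rec_eval_Comp1[OF rec_eval_Proj0 assms])
  then show ?thesis
    unfolding rec_next_test_def by (rule rec_eval_Comp2[OF _ rec_eval_monus branch])
qed

lemma rec_eval_next_element:
  assumes c: "\<And>j. rec_eval c [j] (if j \<in> S then 1 else 0)" and "infinite S"
  shows "rec_eval (Mu (rec_next_test c)) [m] (LEAST j. j \<in> S \<and> m \<le> j)"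
proof -
  define n where "n = (LEAST j. j \<in> S \<and> m \<le> j)"
  have "\<exists>j. j \<in> S \<and> m \<le> j"
    using assms(2) by (auto simp: infinite_nat_iff_unbounded_le)
  then have n: "n \<in> S" "m \<le> n"
    unfolding n_def by (metis (mono_tags, lifting) LeastI_ex)+
  have "rec_eval (rec_next_test c) [n, m] 0"
    using rec_eval_next_test[OF c, of n m] n by simp
  moreover have "\<exists>y. rec_eval (rec_next_test c) [i, m] (Suc y)" if "i < n" for i
  proof -
    have "\<not> (i \<in> S \<and> m \<le> i)"
      using that not_less_Least unfolding n_def by blast
    then have "(if i \<in> S then m - i else 1) = Suc (if i \<in> S then m - i - 1 else 0)"
      by auto
    with rec_eval_next_test[OF c, of i m] show ?thesis by metis
  qed
  ultimately show ?thesis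
    unfolding n_def[symmetric] by (intro rec_eval.Mu) auto
qed

text \<open>
  The element after \<open>enumerate S n\<close> is the least element of \<open>S\<close> from \<open>enumerate S n + 1\<close> on, so the
  enumeration is a primitive recursion over the unbounded search. Infinity of \<open>S\<close> makes every search end.
\<close>

lemma rec_eval_enumerate:
  assumes c: "\<And>j. rec_eval c [j] (if j \<in> S then 1 else 0)" and "infinite S"
  shows "\<exists>e. \<forall>n. rec_eval e [n] (enumerate S n)"
proof -
  define next_el where "next_el = Mu (rec_next_test c)"
  define e where "e = PrimRec (Comp next_el [Zero]) (Comp next_el [Comp Succ [Proj 1]])"
  have next_el: "rec_eval next_el [m] (LEAST j. j \<in> S \<and> m \<le> j)" for m
    unfolding next_el_def by (rule rec_eval_next_element[OF assms])
  have "rec_eval e [n] (enumerate S n)" for n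
  proof (induction n)
    case 0
    have "rec_eval (Comp next_el [Zero]) [] (enumerate S 0)"
      using next_el[of 0] by (auto simp: enumerate_0 intro: rec_eval_Comp1[OF rec_eval.Zero])
    then show ?case
      unfolding e_def by (rule rec_eval.PrimRec_0)
  next
    case (Suc n)
    have "rec_eval next_el [Suc (enumerate S n)] (enumerate S (Suc n))"
      using next_el[of "Suc (enumerate S n)"] \<open>infinite S\<close> by (simp add: enumerate_Suc'' Suc_le_eq)
    then have "rec_eval (Comp next_el [Comp Succ [Proj 1]]) [n, enumerate S n] (enumerate S (Suc n))"
      by (intro rec_eval_Comp1[OF rec_eval_Comp1[OF rec_eval_Proj1 rec_eval.Succ]])
    with Suc show ?case
      unfolding e_def by (rule rec_eval.PrimRec_Suc)
  qed
  then show ?thesis by blast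
qed

text \<open>
  Transported along the numbering of words, the increasing enumeration becomes a function on words.
\<close>

lemma decidable_infinite_imp_computable_injection:
  assumes "finite A" "A \<noteq> {}"
    and Z: "Z \<subseteq> lists A" "infinite Z"
    and dec: "\<And>w. w \<in> lists A \<Longrightarrow> rec_eval c [wnum A w] (if w \<in> Z then 1 else 0)"
  shows "\<exists>h. computable A A h \<and> inj_on h (lists A) \<and> h ` lists A \<subseteq> Z"
proof -
  have bij: "bij_betw (wnum A) (lists A) UNIV"
    using assms(1,2) by (rule bij_betw_wnum)
  then have inj: "inj_on (wnum A) (lists A)" and surj: "wnum A ` lists A = UNIV"
    by (auto simp: bij_betw_def)
  define S where "S = wnum A ` Z"
  have "infinite S"
    unfolding S_def using Z inj finite_imageD inj_on_subset by blast
  have decS: "rec_eval c [j] (if j \<in> S then 1 else 0)" for j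
  proof -
    obtain w where w: "w \<in> lists A" "j = wnum A w"
      using surj by blast
    have "j \<in> S \<longleftrightarrow> w \<in> Z"
      unfolding S_def using w Z(1) inj by (auto dest: inj_onD)
    with dec w show ?thesis by simp
  qed
  from rec_eval_enumerate[OF decS \<open>infinite S\<close>] obtain e
    where e: "rec_eval e [n] (enumerate S n)" for n by blast
  define h where "h w = inv_into Z (wnum A) (enumerate S (wnum A w))" for w
  have in_S: "enumerate S n \<in> wnum A ` Z" for n
    using enumerate_in_set[OF \<open>infinite S\<close>] unfolding S_def .
  have hZ: "h w \<in> Z" and wnum_h: "wnum A (h w) = enumerate S (wnum A w)" for w
    unfolding h_def using in_S by (auto intro: inv_into_into f_inv_into_f)
  have "computable A A h"
    unfolding computable_def partial_computable_def
    using hZ Z(1) by (auto intro!: exI[of _ e] rec_computes_SomeI simp: wnum_h e)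
  moreover have "inj_on h (lists A)"
  proof (rule inj_onI)
    fix v w assume *: "v \<in> lists A" "w \<in> lists A" "h v = h w"
    then have "enumerate S (wnum A v) = enumerate S (wnum A w)"
      using wnum_h by metis
    then have "wnum A v = wnum A w"
      using strict_mono_enumerate[OF \<open>infinite S\<close>] by (simp add: strict_mono_eq)
    with * inj show "v = w" by (auto dest: inj_onD)
  qed
  ultimately show ?thesis using hZ by blast
qed

section \<open>Counting words of bounded complexity\<close>

lemma card_lists_length_le_bound:
  assumes "finite A" "card A \<ge> 2"
  shows "card {xs. set xs \<subseteq> A \<and> length xs \<le> n} \<le> card A ^ Suc n"
proof -
  have "(\<Sum>i\<le>n. card A ^ i) < card A ^ Suc n"
  proof (induction n)
    case (Suc n)
    then have "(\<Sum>i\<le>Suc n. card A ^ i) < 2 * card A ^ Suc n" by simp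
    also have "\<dots> \<le> card A ^ Suc (Suc n)" using assms(2) by simp
    finally show ?case .
  qed (use assms(2) in simp)
  then show ?thesis using assms(1) by (simp add: card_lists_length_le)
qed

text \<open>
  The stop block differs from every letter block and has the same length, so reading block
  by block recovers the letters and detects the end of the program.
\<close>

lemma coded_program_append_inject:
  assumes coding: "program_coding \<Sigma> \<Delta> l block stop"
    and "p \<in> lists \<Delta>" "q \<in> lists \<Delta>"
    and "coded_program block stop p @ u = coded_program block stop q @ v"
  shows "p = q \<and> u = v"
  using assms(2-)
proof (induction p arbitrary: q rule: list.induct)
  case Nil
  then show ?case
    using coding by (cases q) (auto simp: coded_program_def program_coding_def)
next
  case (Cons x p)
  show ?case
  proof (cases q)
    case Nil
    have "x \<in> \<Delta>" using Cons.prems by simp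
    then have "block x \<noteq> stop" "length (block x) = length stop"
      using coding by (auto simp: program_coding_def)
    then show ?thesis
      using Cons.prems Nil by (simp add: coded_program_def)
  next
    case (Cons y q')
    note q = this
    have xy: "x \<in> \<Delta>" "y \<in> \<Delta>" "q' \<in> lists \<Delta>" "p \<in> lists \<Delta>"
      using Cons.prems q by auto
    have "block x @ coded_program block stop p @ u = block y @ coded_program block stop q' @ v"
      using Cons.prems q by (simp add: coded_program_def)
    moreover have "length (block x) = length (block y)"
      using xy coding by (simp add: program_coding_def)
    ultimately have "block x = block y"
      and "coded_program block stop p @ u = coded_program block stop q' @ v"
      by auto
    with Cons.IH xy q coding show ?thesis
      by (auto simp: program_coding_def dest: inj_onD)
  qed
qed

lemma is_description_unique:
  assumes "turing_complete_language \<Sigma> \<Delta> P run" "program_coding \<Sigma> \<Delta> l block stop"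
    and "is_description \<Sigma> P run block stop d w" "is_description \<Sigma> P run block stop d w'"
  shows "w = w'"
proof -
  obtain p v p' v' where "p \<in> P" "d = coded_program block stop p @ v" "run p v = Some w"
    and "p' \<in> P" "d = coded_program block stop p' @ v'" "run p' v' = Some w'"
    using assms(3,4) unfolding is_description_def by blast
  moreover have "P \<subseteq> lists \<Delta>"
    using assms(1) by (simp add: turing_complete_language_def)
  ultimately show ?thesis
    using coded_program_append_inject[OF assms(2), of p p' v v'] by (metis option.inject subsetD)
qed

lemma is_description_in_lists:
  assumes "turing_complete_language \<Sigma> \<Delta> P run" "program_coding \<Sigma> \<Delta> l block stop"
    and "is_description \<Sigma> P run block stop d w"
  shows "d \<in> lists \<Sigma>"
proof -
  obtain p v where "p \<in> P" "v \<in> lists \<Sigma>" and d: "d = coded_program block stop p @ v"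
    using assms(3) unfolding is_description_def by blast
  moreover have "P \<subseteq> lists \<Delta>"
    using assms(1) by (simp add: turing_complete_language_def)
  ultimately show ?thesis
    using assms(2) by (fastforce simp: coded_program_def program_coding_def lists_eq_set)
qed

lemma kolmogorov_complexity_attained:
  assumes "turing_complete_language \<Sigma> \<Delta> P run" "w \<in> lists \<Sigma>"
  shows "\<exists>d. is_description \<Sigma> P run block stop d w \<and>
    length d = kolmogorov_complexity \<Sigma> P run block stop w"
  unfolding kolmogorov_complexity_def
  by (rule LeastI_ex) (use is_description_exists[OF assms] in blast)

lemma kolmogorov_complexity_le_length:
  "is_description \<Sigma> P run block stop d w \<Longrightarrow>
    kolmogorov_complexity \<Sigma> P run block stop w \<le> length d"
  unfolding kolmogorov_complexity_def by (rule Least_le) blast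

lemma card_words_of_complexity_le_upper:
  assumes "finite \<Sigma>" "card \<Sigma> \<ge> 2"
    and lang: "turing_complete_language \<Sigma> \<Delta> P run"
    and coding: "program_coding \<Sigma> \<Delta> l block stop"
  shows "finite (words_of_complexity_le \<Sigma> P run block stop n)"
    and "card (words_of_complexity_le \<Sigma> P run block stop n) \<le> card \<Sigma> ^ Suc n"
proof -
  let ?C = "words_of_complexity_le \<Sigma> P run block stop n"
  let ?D = "{d. set d \<subseteq> \<Sigma> \<and> length d \<le> n}"
  let ?out = "\<lambda>d. THE w. is_description \<Sigma> P run block stop d w"
  have fin: "finite ?D"
    using assms(1) by (rule finite_lists_length_le)
  have sub: "?C \<subseteq> ?out ` ?D"
  proof
    fix w assume "w \<in> ?C"
    then obtain d where d: "is_description \<Sigma> P run block stop d w" "length d \<le> n"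
      using kolmogorov_complexity_attained[OF lang] unfolding words_of_complexity_le_def by force
    from d(1) have "?out d = w"
      by (rule the_equality) (rule is_description_unique[OF lang coding _ d(1)])
    moreover have "d \<in> ?D"
      using d is_description_in_lists[OF lang coding] by auto
    ultimately show "w \<in> ?out ` ?D" by blast
  qed
  show "finite ?C"
    using sub fin finite_subset by blast
  have "card ?C \<le> card ?D"
    using sub fin by (rule surj_card_le[rotated])
  also have "\<dots> \<le> card \<Sigma> ^ Suc n"
    using assms(1,2) by (rule card_lists_length_le_bound)
  finally show "card ?C \<le> card \<Sigma> ^ Suc n" .
qed

text \<open>
  Here \<open>c\<close> is the length of a coded program for \<open>h\<close>: followed by an input \<open>v\<close> of length \<open>n - c\<close>,
  it is a description of \<open>h v\<close> of length \<open>n\<close>.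
\<close>

lemma card_words_of_complexity_le_lower:
  assumes "finite \<Sigma>" "card \<Sigma> \<ge> 2"
    and lang: "turing_complete_language \<Sigma> \<Delta> P run"
    and coding: "program_coding \<Sigma> \<Delta> l block stop"
    and h: "computable \<Sigma> \<Sigma> h" "inj_on h (lists \<Sigma>)" "h ` lists \<Sigma> \<subseteq> Z"
  shows "\<exists>c. \<forall>n\<ge>c. card \<Sigma> ^ (n - c) \<le> card (Z \<inter> words_of_complexity_le \<Sigma> P run block stop n)"
proof -
  from h(1) lang obtain p where p: "p \<in> P" "\<And>v. v \<in> lists \<Sigma> \<Longrightarrow> run p v = Some (h v)"
    unfolding computable_def turing_complete_language_def by meson
  have h_lists: "h v \<in> lists \<Sigma>" if "v \<in> lists \<Sigma>" for v
    using h(1) that unfolding computable_def partial_computable_def by simp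
  define c where "c = length (coded_program block stop p)"
  have "card \<Sigma> ^ (n - c) \<le> card (Z \<inter> words_of_complexity_le \<Sigma> P run block stop n)" if "n \<ge> c" for n
  proof -
    let ?C = "words_of_complexity_le \<Sigma> P run block stop n"
    let ?V = "{v. set v \<subseteq> \<Sigma> \<and> length v = n - c}"
    have V: "?V \<subseteq> lists \<Sigma>" by auto
    have "h v \<in> ?C" if v: "v \<in> ?V" for v
    proof -
      have "is_description \<Sigma> P run block stop (coded_program block stop p @ v) (h v)"
        unfolding is_description_def using p v V by blast
      from kolmogorov_complexity_le_length[OF this] show ?thesis
        unfolding words_of_complexity_le_def
        using v V h_lists \<open>n \<ge> c\<close> by (auto simp: c_def)
    qed
    then have "h ` ?V \<subseteq> Z \<inter> ?C"
      using h(3) V by blast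
    moreover have "finite (Z \<inter> ?C)"
      using card_words_of_complexity_le_upper(1)[OF assms(1,2) lang coding] by blast
    ultimately have "card (h ` ?V) \<le> card (Z \<inter> ?C)"
      by (rule card_mono[rotated])
    moreover have "card (h ` ?V) = card ?V"
      using h(2) V by (intro card_image) (rule inj_on_subset)
    ultimately show ?thesis
      using card_lists_length_eq[OF assms(1)] by metis
  qed
  then show ?thesis by blast
qed

section \<open>Positive lower density\<close>

theorem corollary2:
  fixes \<Sigma> \<Delta> :: "'a set"
    and P :: "'a list set"
    and run :: "'a list \<Rightarrow> 'a list \<Rightarrow> 'a list option"
    and l :: nat
    and block :: "'a \<Rightarrow> 'a list"
    and stop :: "'a list"
    and \<Gamma> :: "'c set"
    and code :: "'t \<Rightarrow> 'c list"
    and T Y :: "'t set"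
    and \<iota> :: "'a list \<Rightarrow> 't"
  assumes "finite \<Sigma>" "card \<Sigma> \<ge> 2"
    and "turing_complete_language \<Sigma> \<Delta> P run"
    and "program_coding \<Sigma> \<Delta> l block stop"
    and "finite \<Gamma>" "code ` T \<subseteq> lists \<Gamma>" "inj_on code T"
    and "computably_enumerable \<Gamma> (code ` T)"
    and "bij_betw \<iota> (lists \<Sigma>) T" "computable \<Sigma> \<Gamma> (\<lambda>w. code (\<iota> w))"
    and "decidable_subset \<Gamma> code T Y" "infinite Y"
  shows "lower_asymptotic_density (\<lambda>n. \<iota> ` words_of_complexity_le \<Sigma> P run block stop n) Y > 0"
proof -
  let ?C = "words_of_complexity_le \<Sigma> P run block stop"
  define Z where "Z = {w \<in> lists \<Sigma>. \<iota> w \<in> Y}"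
  define k where "k = card \<Sigma>"
  have "\<Sigma> \<noteq> {}" and "k \<ge> 2" using assms(2) by (auto simp: k_def)
  have "inj_on \<iota> (lists \<Sigma>)" and "\<iota> ` lists \<Sigma> = T"
    using assms(9) by (auto simp: bij_betw_def)
  obtain d where "Y \<subseteq> T"
    and d: "\<And>t. t \<in> T \<Longrightarrow> rec_eval d [wnum \<Gamma> (code t)] (if t \<in> Y then 1 else 0)"
    using assms(11) unfolding decidable_subset_def by blast
  obtain f where f: "\<And>w. w \<in> lists \<Sigma> \<Longrightarrow> rec_eval f [wnum \<Sigma> w] (wnum \<Gamma> (code (\<iota> w)))"
    using assms(10) rec_computes_SomeD unfolding computable_def partial_computable_def
    by (metis option.simps(9))
  have "\<iota> ` Z = Y"
    using \<open>Y \<subseteq> T\<close> \<open>\<iota> ` lists \<Sigma> = T\<close> by (auto simp: Z_def)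
  then have "infinite Z"
    using assms(12) finite_imageI by blast
  have "rec_eval (Comp d [f]) [wnum \<Sigma> w] (if w \<in> Z then 1 else 0)" if "w \<in> lists \<Sigma>" for w
  proof -
    have "\<iota> w \<in> T" using that \<open>\<iota> ` lists \<Sigma> = T\<close> by blast
    from rec_eval_Comp1[OF f[OF that] d[OF this]] show ?thesis
      using that by (simp add: Z_def)
  qed
  then obtain h where "computable \<Sigma> \<Sigma> h" "inj_on h (lists \<Sigma>)" "h ` lists \<Sigma> \<subseteq> Z"
    using decidable_infinite_imp_computable_injection[OF assms(1) \<open>\<Sigma> \<noteq> {}\<close> _ \<open>infinite Z\<close>]
    by (metis (no_types, lifting) Z_def mem_Collect_eq subsetI)
  from card_words_of_complexity_le_lower[OF assms(1-4) this]
  obtain c where lower: "\<And>n. n \<ge> c \<Longrightarrow> k ^ (n - c) \<le> card (Z \<inter> ?C n)"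
    unfolding k_def by blast
  have ratio: "1 / real k ^ Suc c \<le> real (card (Y \<inter> \<iota> ` ?C n)) / real (card (\<iota> ` ?C n))"
    if "n \<ge> c" for n
  proof -
    have sub: "?C n \<subseteq> lists \<Sigma>" by (auto simp: words_of_complexity_le_def)
    have "Y \<inter> \<iota> ` ?C n = \<iota> ` (Z \<inter> ?C n)"
      using sub by (auto simp: Z_def)
    then have num: "card (Y \<inter> \<iota> ` ?C n) = card (Z \<inter> ?C n)"
      using \<open>inj_on \<iota> (lists \<Sigma>)\<close> sub by (simp add: card_image inj_on_subset le_infI2)
    have den: "card (\<iota> ` ?C n) = card (?C n)"
      using \<open>inj_on \<iota> (lists \<Sigma>)\<close> sub by (simp add: card_image inj_on_subset)
    have upper: "card (?C n) \<le> k ^ Suc n"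
      unfolding k_def by (rule card_words_of_complexity_le_upper(2)[OF assms(1-4)])
    have "0 < k ^ (n - c)" using \<open>k \<ge> 2\<close> by simp
    also have "\<dots> \<le> card (Z \<inter> ?C n)" by (rule lower[OF that])
    also have "\<dots> \<le> card (?C n)"
      by (intro card_mono card_words_of_complexity_le_upper(1)[OF assms(1-4)]) auto
    finally have pos: "0 < card (?C n)" .
    have "k ^ Suc n = k ^ Suc c * k ^ (n - c)"
      using that by (simp only: power_add[symmetric] add_Suc le_add_diff_inverse)
    with upper have "card (?C n) \<le> k ^ Suc c * k ^ (n - c)" by metis
    also have "\<dots> \<le> k ^ Suc c * card (Z \<inter> ?C n)"
      using lower[OF that] by (rule mult_le_mono2)
    finally have "real (card (?C n)) \<le> real (k ^ Suc c * card (Z \<inter> ?C n))"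
      by (rule of_nat_mono)
    then show ?thesis
      using pos \<open>k \<ge> 2\<close> unfolding num den by (simp add: divide_simps mult_ac)
  qed
  have "0 < ereal (1 / real k ^ Suc c)"
    using \<open>k \<ge> 2\<close> by simp
  also have "\<dots> \<le> lower_asymptotic_density (\<lambda>n. \<iota> ` ?C n) Y"
    unfolding lower_asymptotic_density_def
    using ratio by (intro Liminf_bounded eventually_sequentiallyI[of c]) simp
  finally show ?thesis .
qed

end
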